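(* Let $(E,\|\cdot\|_E)$ be a Banach space such that $\mathcal{S}(\mathbb{R}^d)\subset E\subset\mathcal{S}'(\mathbb{R}^d)$, and let $\beta\in\mathbb{R}$. Suppose that: 1) there exists a constant $C>0$ such that $\|\mathds{1}_{\{1\leq|\xi|\leq2\}}\widehat{\vec{\psi}}(\cdot)\|_{L^1}\leq C\|\vec{\psi}\|_E$ for all $\vec{\psi}\in E$; and 2) $\|\lambda^\beta\vec{\psi}(\lambda\cdot)\|_E=\|\vec{\psi}\|_E$ for all $\lambda>0$ (and all $\vec{\psi}\in E$). Then $E\subset\dot{\mathscr{B}}^{-\beta,\infty}_{L^1_\xi}(\mathbb{R}^d)$. In particular, if for some indexes $1<p,q<+\infty$ and $1<\alpha<2$ we have $\frac{\alpha}{p}+\frac{d}{q'}=\beta$ (with $\frac1q+\frac1{q'}=1$), then $$\dot{\mathscr{B}}^{-\frac{\alpha}{p},\infty}_{L^{q,\infty}_\xi}(\mathbb{R}^d)\subset\dot{\mathscr{B}}^{-\beta,\infty}_{L^1_\xi}(\mathbb{R}^d).$$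
   Context: $d\ge2$ is a fixed dimension. Elements of the spaces are $\mathbb{R}^d$-valued tempered distributions; $\mathcal{S}$ and $\mathcal{S}'$ are the Schwartz space and the space of tempered distributions; $\widehat{\vec{\psi}}$ is the Fourier transform in the space variable, with frequency variable $\xi\in\mathbb{R}^d$. For $1\le q<+\infty$, $\|g\|_{L^{q,\infty}}=\sup_{\lambda>0}\lambda\,|\{x:|g(x)|>\lambda\}|^{1/q}$, and $L^{q,\infty}$ is the corresponding Lorentz (weak-$L^q$) space. For $\mathfrak{s}\in\mathbb{R}$ and $1<q<+\infty$, the Fourier-Besov-Lorentz space $\dot{\mathscr{B}}^{\mathfrak{s},\infty}_{L^{q,\infty}_\xi}(\mathbb{R}^d)$ is the space of tempered distributions $\vec{\psi}$ modulo polynomials with $$\|\vec{\psi}\|_{\dot{\mathscr{B}}^{\mathfrak{s},\infty}_{L^{q,\infty}_\xi}}=\sup_{j\in\mathbb{Z}}2^{j\mathfrak{s}}\big\|\mathds{1}_{\{2^j\le|\xi|\le2^{j+1}\}}\widehat{\vec{\psi}}\big\|_{L^{q,\infty}}<+\infty,$$ and $\dot{\mathscr{B}}^{\mathfrak{s},\infty}_{L^{1}_\xi}(\mathbb{R}^d)$ is defined in the same way with $L^{q,\infty}$ replaced by the Lebesgue space $L^1$: $$\|\vec{\psi}\|_{\dot{\mathscr{B}}^{\mathfrak{s},\infty}_{L^{1}_\xi}}=\sup_{j\in\mathbb{Z}}2^{j\mathfrak{s}}\big\|\mathds{1}_{\{2^j\le|\xi|\le2^{j+1}\}}\widehat{\vec{\psi}}\big\|_{L^{1}}<+\infty.$$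 *)

theory Defs
  imports "HOL-Analysis.Analysis" "HOL-Library.Function_Algebras"
begin

text \<open>Functions with values in a real vector space form a real vector space under the pointwise
  operations; this makes \<^const>\<open>subspace\<close> available for spaces of distributions.\<close>

instantiation "fun" :: (type, real_vector) real_vector
begin

definition scaleR_fun :: "real \<Rightarrow> ('a \<Rightarrow> 'b) \<Rightarrow> 'a \<Rightarrow> 'b"
  where "scaleR_fun r f = (\<lambda>x. r *\<^sub>R f x)"

instance
  by standard (simp_all add: scaleR_fun_def fun_eq_iff scaleR_add_right scaleR_add_left)

end

subsection \<open>Schwartz functions and tempered distributions\<close>

text \<open>\<open>iter_partial [i\<^sub>1, \<dots>, i\<^sub>m] f\<close> is \<open>\<partial>\<^bsub>i\<^sub>1\<^esub> \<dots> \<partial>\<^bsub>i\<^sub>m\<^esub> f\<close>.\<close>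

primrec iter_partial :: "'n::finite list \<Rightarrow> (real^'n \<Rightarrow> 'b::real_normed_vector) \<Rightarrow> real^'n \<Rightarrow> 'b"
  where
    "iter_partial [] f = f"
  | "iter_partial (i # is) f = (\<lambda>x. frechet_derivative (iter_partial is f) (at x) (axis i 1))"

text \<open>Smoothness is the first conjunct: every iterated partial derivative is differentiable at
  every point.\<close>

definition schwartz :: "(real^'n::finite \<Rightarrow> 'b::real_normed_vector) set"
  where "schwartz = {f. \<forall>is. (\<forall>x. iter_partial is f differentiable (at x)) \<and>
                       (\<forall>k::nat. bounded (range (\<lambda>x. norm x ^ k *\<^sub>R iter_partial is f x)))}"

definition schwartz_seminorm ::
    "nat \<Rightarrow> 'n::finite list \<Rightarrow> (real^'n \<Rightarrow> 'b::real_normed_vector) \<Rightarrow> real"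
  where "schwartz_seminorm k is f = (SUP x. norm x ^ k * norm (iter_partial is f x))"

definition schwartz_topology :: "(real^'n::finite \<Rightarrow> 'b::real_normed_vector) topology"
  where "schwartz_topology = topology_generated_by
    {{g \<in> schwartz. schwartz_seminorm k is (g - f) < e} | f k is e. f \<in> schwartz \<and> (e::real) > 0}"

text \<open>A vector-valued distribution is a map from complex test functions to \<open>\<complex>\<^sup>d\<close>. The value at
  \<open>\<phi>\<close> of one given by a function \<open>g\<close> is \<open>\<integral> \<phi> g\<close>, with no complex conjugation.\<close>

type_synonym 'n distribution = "(real^'n \<Rightarrow> complex) \<Rightarrow> complex^'n"

text \<open>The \<open>\<real>\<^sup>d\<close>-valued tempered distributions are the continuous complex-linear maps that take real
  values on real test functions (equivalently, commute with conjugation). As test functions form a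
  set and not a type, the value outside \<^const>\<open>schwartz\<close> is fixed to be \<open>0\<close>, so that equality of
  distributions is equality of maps.\<close>

definition tempered :: "'n::finite distribution set"
  where "tempered = {T.
    (\<forall>a b. \<forall>\<phi>\<in>schwartz. \<forall>\<eta>\<in>schwartz.
       T (\<lambda>x. a * \<phi> x + b * \<eta> x) = a *s T \<phi> + b *s T \<eta>) \<and>
    continuous_map schwartz_topology euclidean T \<and>
    (\<forall>\<phi>\<in>schwartz. \<forall>i. T (\<lambda>x. cnj (\<phi> x)) $ i = cnj (T \<phi> $ i)) \<and>
    (\<forall>\<phi>. \<phi> \<notin> schwartz \<longrightarrow> T \<phi> = 0)}"

definition regular_distribution :: "(real^'n::finite \<Rightarrow> real^'n) \<Rightarrow> 'n distribution"
  where "regular_distribution f =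
    (\<lambda>\<phi>. if \<phi> \<in> schwartz then LINT x|lborel. \<phi> x *s (\<chi> i. complex_of_real (f x $ i)) else 0)"

definition fourier :: "(real^'n::finite \<Rightarrow> complex) \<Rightarrow> real^'n \<Rightarrow> complex"
  where "fourier \<phi> \<xi> = (LINT x|lborel. exp (- (\<i> * complex_of_real (x \<bullet> \<xi>))) * \<phi> x)"

definition fourier_distribution :: "'n::finite distribution \<Rightarrow> 'n distribution"
  where "fourier_distribution T = (\<lambda>\<phi>. if \<phi> \<in> schwartz then T (fourier \<phi>) else 0)"

text \<open>\<open>dilation r T\<close> is \<open>T(r\<cdot>)\<close> for \<open>r > 0\<close>; the formula is the change of variables
  \<open>\<integral> \<phi>(x) f(r x) dx = r\<^sup>-\<^sup>d \<integral> \<phi>(x/r) f(x) dx\<close>.\<close>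

definition dilation :: "real \<Rightarrow> 'n::finite distribution \<Rightarrow> 'n distribution"
  where "dilation r T = (\<lambda>\<phi>. inverse (r ^ CARD('n)) *\<^sub>R T (\<lambda>x. \<phi> (inverse r *\<^sub>R x)))"

definition mod_polynomials :: "('n::finite distribution \<times> 'n distribution) set"
  where "mod_polynomials = {(S, T). S \<in> tempered \<and> T \<in> tempered \<and>
           (\<exists>P. polynomial_function P \<and> S - T = regular_distribution P)}"

subsection \<open>Banach spaces of distributions\<close>

definition banach_space_on :: "'v::real_vector set \<Rightarrow> ('v \<Rightarrow> real) \<Rightarrow> bool"
  where "banach_space_on E N \<longleftrightarrow>
    subspace E \<and>
    (\<forall>u\<in>E. 0 \<le> N u \<and> (N u = 0 \<longleftrightarrow> u = 0)) \<and>
    (\<forall>u\<in>E. \<forall>c. N (c *\<^sub>R u) = \<bar>c\<bar> * N u) \<and>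
    (\<forall>u\<in>E. \<forall>v\<in>E. N (u + v) \<le> N u + N v) \<and>
    Metric_space.mcomplete E (\<lambda>u v. N (u - v))"

subsection \<open>Fourier--Besov spaces\<close>

definition L1_norm :: "(real^'n::finite \<Rightarrow> 'b::real_normed_vector) \<Rightarrow> ennreal"
  where "L1_norm g = (\<integral>\<^sup>+ x. ennreal (norm (g x)) \<partial>lborel)"

definition weak_norm :: "real \<Rightarrow> (real^'n::finite \<Rightarrow> 'b::real_normed_vector) \<Rightarrow> ennreal"
  where "weak_norm q g = (SUP l\<in>{0<..}. ennreal l *
    (let m = emeasure lborel {x. l < norm (g x)}
     in if m = \<infinity> then \<infinity> else ennreal (enn2real m powr (1 / q))))"

text \<open>The distribution \<open>T\<close> coincides on the open set \<open>U\<close> with the locally integrable function \<open>g\<close>.\<close>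

definition agrees_on :: "'n::finite distribution \<Rightarrow> (real^'n \<Rightarrow> complex^'n) \<Rightarrow> (real^'n) set \<Rightarrow> bool"
  where "agrees_on T g U \<longleftrightarrow>
    (\<forall>K. compact K \<and> K \<subseteq> U \<longrightarrow> set_integrable lborel K g) \<and>
    (\<forall>\<phi>\<in>schwartz. compact (closure {x. \<phi> x \<noteq> 0}) \<and> closure {x. \<phi> x \<noteq> 0} \<subseteq> U \<longrightarrow>
       T \<phi> = (LINT x|lborel. \<phi> x *s g x))"

text \<open>The norm of \<open>\<one>\<^sub>A T\<close>, for a compact set \<open>A\<close>. The product of the discontinuous function
  \<open>\<one>\<^sub>A\<close> with \<open>T\<close> makes sense when \<open>T\<close> is a locally integrable function \<open>g\<close> near \<open>A\<close>; such a \<open>g\<close> is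
  unique almost everywhere on \<open>A\<close>, so that the infimum is over a single value. When there is no
  such \<open>g\<close>, it is the infimum of the empty set, \<open>\<infinity>\<close>.\<close>

definition restricted_norm ::
    "((real^'n::finite \<Rightarrow> complex^'n) \<Rightarrow> ennreal) \<Rightarrow> (real^'n) set \<Rightarrow> 'n distribution \<Rightarrow> ennreal"
  where "restricted_norm X A T =
    (INF g\<in>{g. \<exists>U. open U \<and> A \<subseteq> U \<and> agrees_on T g U}. X (\<lambda>x. indicat_real A x *\<^sub>R g x))"

definition annulus :: "real \<Rightarrow> real \<Rightarrow> (real^'n::finite) set"
  where "annulus a b = {\<xi>. a \<le> norm \<xi> \<and> norm \<xi> \<le> b}"

definition fourier_besov_norm ::
    "((real^'n::finite \<Rightarrow> complex^'n) \<Rightarrow> ennreal) \<Rightarrow> real \<Rightarrow> 'n distribution \<Rightarrow> ennreal"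
  where "fourier_besov_norm X s T =
    (SUP j::int. ennreal (2 powr (real_of_int j * s)) *
       restricted_norm X (annulus (2 powi j) (2 powi (j + 1))) (fourier_distribution T))"

text \<open>The norm does not see polynomials, whose Fourier transforms are supported at the origin. The
  elements of the space are classes modulo polynomials.\<close>

definition fourier_besov ::
    "((real^'n::finite \<Rightarrow> complex^'n) \<Rightarrow> ennreal) \<Rightarrow> real \<Rightarrow> 'n distribution set set"
  where "fourier_besov X s = {T \<in> tempered. fourier_besov_norm X s T < \<infinity>} // mod_polynomials"

end

theory Submission
  imports Defs
begin

text \<open>The dilation \<open>r\<^sup>\<beta> \<psi>(r\<cdot>)\<close> with \<open>r = 2\<^sup>-\<^sup>j\<close> turns the frequency annulus at scale \<open>2\<^sup>j\<close> into the
  unit annulus and multiplies the \<open>L\<^sup>1\<close> norm of the Fourier transform there by \<open>r\<^sup>\<beta>\<close>, so that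
  assumption (1) for the dilated distributions, together with assumption (2), bounds every
  dyadic block at once. The inclusion of the Lorentz space is Hoelder's inequality on each
  annulus, which has measure comparable to \<open>2\<^sup>j\<^sup>d\<close>; it costs the factor \<open>2\<close> to the power \<open>jd/q'\<close>.\<close>

section \<open>Change of variables under dilations of Euclidean space\<close>

lemma lborel_scaleR:
  assumes "r > 0"
  shows "(lborel :: 'a::euclidean_space measure) =
    density (distr lborel borel ((*\<^sub>R) r)) (\<lambda>_. ennreal (r ^ DIM('a)))"
  using lborel_affine[of r "0::'a"] assms by (simp add: abs_of_pos)

lemma nn_integral_lborel_scaleR:
  fixes f :: "'a::euclidean_space \<Rightarrow> ennreal"
  assumes r: "r > 0" and f[measurable]: "f \<in> borel_measurable borel"
  shows "(\<integral>\<^sup>+x. f x \<partial>lborel) = ennreal (r ^ DIM('a)) * (\<integral>\<^sup>+x. f (r *\<^sub>R x) \<partial>lborel)"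
  by (subst lborel_scaleR[OF r]) (simp add: nn_integral_density nn_integral_distr nn_integral_cmult)

lemma borel_measurable_scaleR_iff:
  fixes f :: "'a::euclidean_space \<Rightarrow> 'b::topological_space"
  assumes "r \<noteq> 0"
  shows "(\<lambda>x. f (r *\<^sub>R x)) \<in> borel_measurable borel \<longleftrightarrow> f \<in> borel_measurable borel"
proof
  assume "(\<lambda>x. f (r *\<^sub>R x)) \<in> borel_measurable borel"
  from measurable_compose[OF _ this, of "(*\<^sub>R) (inverse r)" borel]
  show "f \<in> borel_measurable borel" using assms by simp
next
  assume "f \<in> borel_measurable borel"
  from measurable_compose[OF _ this, of "(*\<^sub>R) r" borel]
  show "(\<lambda>x. f (r *\<^sub>R x)) \<in> borel_measurable borel" by simp
qed

text \<open>For measurable f the two sides differ by the constant Jacobian. For non-measurable f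
  both sides are false, because measurability is itself invariant under dilation; hence f can be
  arbitrary.\<close>

lemma integrable_lborel_scaleR_iff:
  fixes f :: "'a::euclidean_space \<Rightarrow> 'b::{banach, second_countable_topology}"
  assumes r: "r > 0"
  shows "integrable lborel (\<lambda>x. f (r *\<^sub>R x)) \<longleftrightarrow> integrable lborel f"
proof (cases "f \<in> borel_measurable borel")
  case [measurable]: True
  have "integrable lborel f \<longleftrightarrow>
    integrable (density (distr lborel borel ((*\<^sub>R) r)) (\<lambda>_. ennreal (r ^ DIM('a)))) f"
    by (subst lborel_scaleR[OF r]) simp
  also have "\<dots> \<longleftrightarrow> integrable (distr lborel borel ((*\<^sub>R) r)) (\<lambda>x. r ^ DIM('a) *\<^sub>R f x)"
    using r by (intro integrable_density) auto
  also have "\<dots> \<longleftrightarrow> integrable lborel (\<lambda>x. r ^ DIM('a) *\<^sub>R f (r *\<^sub>R x))"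
    by (intro integrable_distr_eq) auto
  also have "\<dots> \<longleftrightarrow> integrable lborel (\<lambda>x. f (r *\<^sub>R x))"
    using r integrable_scaleR_right[of "inverse (r ^ DIM('a))" lborel "\<lambda>x. r ^ DIM('a) *\<^sub>R f (r *\<^sub>R x)"]
    by auto
  finally show ?thesis by simp
next
  case False
  with borel_measurable_scaleR_iff[of r f] r show ?thesis
    by (auto dest: borel_measurable_integrable)
qed

text \<open>If f is not integrable, neither is its dilation, and both integrals have the default
  value 0. This lets the formula be used without any integrability check in
  \<open>fourier_scaleR\<close> and \<open>agrees_on_dilation\<close>.\<close>

lemma integral_lborel_scaleR:
  fixes f :: "'a::euclidean_space \<Rightarrow> 'b::{banach, second_countable_topology}"
  assumes r: "r > 0"
  shows "(LINT x|lborel. f x) = r ^ DIM('a) *\<^sub>R (LINT x|lborel. f (r *\<^sub>R x))"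
proof (cases "integrable lborel f")
  case True
  then have [measurable]: "f \<in> borel_measurable borel"
    by (auto dest: borel_measurable_integrable)
  have "(LINT x|lborel. f x) =
    (LINT x|density (distr lborel borel ((*\<^sub>R) r)) (\<lambda>_. ennreal (r ^ DIM('a))). f x)"
    by (subst lborel_scaleR[OF r]) simp
  also have "\<dots> = (LINT x|distr lborel borel ((*\<^sub>R) r). r ^ DIM('a) *\<^sub>R f x)"
    using r by (intro integral_density) auto
  also have "\<dots> = (LINT x|lborel. r ^ DIM('a) *\<^sub>R f (r *\<^sub>R x))"
    by (intro integral_distr) auto
  finally show ?thesis by simp
next
  case False
  with integrable_lborel_scaleR_iff[OF r, of f] show ?thesis
    by (simp add: not_integrable_integral_eq)
qed

section \<open>Test functions under dilation and multiplication by constants\<close>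

text \<open>By the chain rule every differentiation evaluates the derivative at \<open>c\<close>
  times a basis vector; linearity pulls out one factor \<open>c\<close> for each entry of the
  list.\<close>

lemma iter_partial_scaleR:
  fixes f :: "real^'n::finite \<Rightarrow> 'b::real_normed_vector"
  assumes "\<And>js x. iter_partial js f differentiable (at x)"
  shows "iter_partial js (\<lambda>x. f (c *\<^sub>R x)) = (\<lambda>x. c ^ length js *\<^sub>R iter_partial js f (c *\<^sub>R x))"
proof (induction js)
  case Nil
  then show ?case by simp
next
  case (Cons i js)
  show ?case
  proof
    fix x
    let ?F = "iter_partial js f"
    let ?F' = "frechet_derivative ?F (at (c *\<^sub>R x))"
    have F': "(?F has_derivative ?F') (at (c *\<^sub>R x))"
      using assms frechet_derivative_works by blast
    have "((\<lambda>x. ?F (c *\<^sub>R x)) has_derivative (\<lambda>h. ?F' (c *\<^sub>R h))) (at x)"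
      by (rule has_derivative_compose[of "\<lambda>x. c *\<^sub>R x", OF _ F']) (auto intro!: derivative_eq_intros)
    then have "((\<lambda>x. c ^ length js *\<^sub>R ?F (c *\<^sub>R x)) has_derivative
        (\<lambda>h. c ^ length js *\<^sub>R ?F' (c *\<^sub>R h))) (at x)"
      by (rule has_derivative_scaleR_right)
    from frechet_derivative_at[OF this, symmetric]
    show "iter_partial (i # js) (\<lambda>x. f (c *\<^sub>R x)) x =
        c ^ length (i # js) *\<^sub>R iter_partial (i # js) f (c *\<^sub>R x)"
      using linear_scale[OF has_derivative_linear[OF F']] by (simp add: Cons mult.commute)
  qed
qed

lemma schwartz_scaleR:
  fixes f :: "real^'n::finite \<Rightarrow> 'b::real_normed_vector"
  assumes f: "f \<in> schwartz" and c: "c \<noteq> 0"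
  shows "(\<lambda>x. f (c *\<^sub>R x)) \<in> schwartz"
proof -
  have diff: "iter_partial js f differentiable (at x)" for js x
    using f by (auto simp: schwartz_def)
  have "(\<lambda>x. c ^ length js *\<^sub>R iter_partial js f (c *\<^sub>R x)) differentiable (at x)" for js x
  proof -
    have "(\<lambda>x. c *\<^sub>R x) differentiable (at x)"
      by (rule bounded_linear_imp_differentiable[OF bounded_linear_scaleR_right])
    from differentiable_chain_at[OF this diff]
    have "(\<lambda>x. iter_partial js f (c *\<^sub>R x)) differentiable (at x)"
      by (simp add: o_def)
    from differentiable_scaleR[OF differentiable_const this] show ?thesis .
  qed
  moreover have "bounded (range (\<lambda>x. norm x ^ k *\<^sub>R (c ^ length js *\<^sub>R iter_partial js f (c *\<^sub>R x))))"
    for k js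
  proof -
    let ?G = "\<lambda>x. norm x ^ k *\<^sub>R iter_partial js f x"
    have "bounded (range ?G)" using f by (auto simp: schwartz_def)
    then have "bounded ((*\<^sub>R) (c ^ length js / \<bar>c\<bar> ^ k) ` range ?G)" by (rule bounded_scaling)
    \<comment> \<open>The weight is rewritten at the point \<open>c\<close> times \<open>x\<close>,
      where the norm is larger by the factor |c|; this explains the division by |c|^k.\<close>
    moreover have "norm x ^ k *\<^sub>R (c ^ length js *\<^sub>R iter_partial js f (c *\<^sub>R x)) =
        (c ^ length js / \<bar>c\<bar> ^ k) *\<^sub>R ?G (c *\<^sub>R x)" for x
      using c by (simp add: power_mult_distrib)
    ultimately show ?thesis
      by (elim bounded_subset) (simp only: image_subset_iff, blast)
  qed
  ultimately show ?thesis
    by (simp add: schwartz_def iter_partial_scaleR[OF diff])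
qed

lemma schwartz_mult:
  fixes f :: "real^'n::finite \<Rightarrow> complex"
  assumes f: "f \<in> schwartz"
  shows "(\<lambda>x. a * f x) \<in> schwartz"
proof -
  have diff: "iter_partial js f differentiable (at x)" for js x
    using f by (auto simp: schwartz_def)
  have eq: "iter_partial js (\<lambda>x. a * f x) = (\<lambda>x. a * iter_partial js f x)" for js
  proof (induction js)
    case (Cons i js)
    have "((\<lambda>x. a * iter_partial js f x) has_derivative
        (\<lambda>h. a * frechet_derivative (iter_partial js f) (at x) h)) (at x)" for x
      by (intro has_derivative_mult_right) (use diff frechet_derivative_works in blast)
    from frechet_derivative_at[OF this, symmetric] show ?case by (simp add: Cons)
  qed simp
  have "bounded (range (\<lambda>x. norm x ^ k *\<^sub>R (a * iter_partial js f x)))" for k js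
  proof -
    have "bounded (range (\<lambda>x. norm x ^ k *\<^sub>R iter_partial js f x))"
      using f by (auto simp: schwartz_def)
    from bounded_linear_image[OF this bounded_linear_mult_right[of a]]
    show ?thesis by (simp add: image_image)
  qed
  moreover have "(\<lambda>x. a * iter_partial js f x) differentiable (at x)" for js x
    by (rule differentiable_mult[OF differentiable_const diff])
  ultimately show ?thesis by (simp add: schwartz_def eq)
qed

text \<open>Since \<open>T\<close> is \<open>0\<close> outside \<^const>\<open>schwartz\<close>, homogeneity holds for every \<open>\<phi>\<close>. It can thus be
  applied to \<^term>\<open>fourier \<phi>\<close> without knowing that this is a Schwartz function.\<close>

lemma tempered_mult:
  assumes T: "T \<in> tempered" and a: "a \<noteq> 0"
  shows "T (\<lambda>x. a * \<phi> x) = a *s T \<phi>"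
proof (cases "\<phi> \<in> schwartz")
  case True
  then have "T (\<lambda>x. a * \<phi> x + 0 * \<phi> x) = a *s T \<phi> + 0 *s T \<phi>"
    using T unfolding tempered_def by blast
  then show ?thesis by simp
next
  case False
  moreover have "(\<lambda>x. a * \<phi> x) \<notin> schwartz"
    using schwartz_mult[of "\<lambda>x. a * \<phi> x" "inverse a"] a False by (auto simp: mult.assoc[symmetric])
  ultimately show ?thesis using T by (simp add: tempered_def)
qed

section \<open>Fourier transforms of dilated distributions\<close>

text \<open>Substituting x = r y leaves the phase unchanged, since the dilations of y and \<xi>
  cancel in the inner product; only the Jacobian r^d remains.\<close>

lemma fourier_scaleR:
  fixes \<phi> :: "real^'n::finite \<Rightarrow> complex"
  assumes "r > 0"
  shows "fourier (\<lambda>x. \<phi> (inverse r *\<^sub>R x)) (inverse r *\<^sub>R \<xi>) = complex_of_real (r ^ CARD('n)) * fourier \<phi> \<xi>"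
  unfolding fourier_def
  by (subst integral_lborel_scaleR[OF assms])
     (use assms in \<open>simp add: scaleR_conv_of_real[where 'a = complex] mult.assoc[symmetric]\<close>)

text \<open>The test function is rescaled so that the factor r^d from its Fourier transform cancels
  the r^(-d) in the definition of \<open>dilation\<close>.\<close>

lemma fourier_distribution_dilation:
  fixes T :: "'n::finite distribution"
  assumes T: "T \<in> tempered" and r: "r > 0" and \<phi>: "\<phi> \<in> schwartz"
  shows "fourier_distribution (c *\<^sub>R dilation r T) (\<lambda>x. \<phi> (inverse r *\<^sub>R x)) =
    c *\<^sub>R fourier_distribution T \<phi>"
proof -
  have "(\<lambda>x. \<phi> (inverse r *\<^sub>R x)) \<in> schwartz"
    using \<phi> r by (intro schwartz_scaleR) auto
  moreover have "complex_of_real (r ^ CARD('n)) *s T (fourier \<phi>) = r ^ CARD('n) *\<^sub>R T (fourier \<phi>)"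
    by (simp add: vec_eq_iff scaleR_conv_of_real[where 'a = complex])
  moreover have "T (\<lambda>x. complex_of_real (r ^ CARD('n)) * fourier \<phi> x) =
      complex_of_real (r ^ CARD('n)) *s T (fourier \<phi>)"
    using r by (intro tempered_mult[OF T]) simp
  ultimately show ?thesis
    using \<phi> r by (simp only: fourier_distribution_def scaleR_fun_def dilation_def fourier_scaleR[OF r]) simp
qed

text \<open>Formally the Fourier transform of c T(r x) is c r^(-d) times that of T at \<xi>/r.
  Solving for the transform of T turns a density \<open>g\<close> for the dilated distribution into
  one for \<open>T\<close>.\<close>

lemma agrees_on_dilation:
  fixes T :: "'n::finite distribution"
  assumes T: "T \<in> tempered" and r: "r > 0" and c: "c > 0"
    and g: "agrees_on (fourier_distribution (c *\<^sub>R dilation r T)) g U"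
  shows "agrees_on (fourier_distribution T) (\<lambda>x. (r ^ CARD('n) / c) *\<^sub>R g (r *\<^sub>R x)) ((*\<^sub>R) r -` U)"
  unfolding agrees_on_def
proof (intro conjI allI ballI impI)
  fix K :: "(real^'n) set"
  assume K: "compact K \<and> K \<subseteq> (*\<^sub>R) r -` U"
  have "compact ((*\<^sub>R) r ` K)" "(*\<^sub>R) r ` K \<subseteq> U"
    using K compact_scaling by auto
  then have "set_integrable lborel ((*\<^sub>R) r ` K) g"
    using g by (simp add: agrees_on_def)
  then have "integrable lborel (\<lambda>x. indicat_real ((*\<^sub>R) r ` K) (r *\<^sub>R x) *\<^sub>R g (r *\<^sub>R x))"
    using integrable_lborel_scaleR_iff[OF r, of "\<lambda>x. indicat_real ((*\<^sub>R) r ` K) x *\<^sub>R g x"]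
    by (simp add: set_integrable_def)
  moreover have "indicat_real ((*\<^sub>R) r ` K) (r *\<^sub>R x) = indicat_real K x" for x
    using r by (auto simp: indicator_def)
  ultimately have "set_integrable lborel K (\<lambda>x. g (r *\<^sub>R x))"
    by (simp add: set_integrable_def)
  then show "set_integrable lborel K (\<lambda>x. (r ^ CARD('n) / c) *\<^sub>R g (r *\<^sub>R x))"
    by (rule set_integrable_scaleR_right)
next
  fix \<phi> :: "real^'n \<Rightarrow> complex"
  assume \<phi>: "\<phi> \<in> schwartz"
    and supp: "compact (closure {x. \<phi> x \<noteq> 0}) \<and> closure {x. \<phi> x \<noteq> 0} \<subseteq> (*\<^sub>R) r -` U"
  let ?\<phi> = "\<lambda>x. \<phi> (inverse r *\<^sub>R x)"
  \<comment> \<open>The rescaled test function has its support enlarged by the factor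
    \<open>r\<close>, which places it inside \<open>U\<close>, where \<open>g\<close> represents the
    dilated transform.\<close>
  have "{x. ?\<phi> x \<noteq> 0} = (*\<^sub>R) r ` {x. \<phi> x \<noteq> 0}"
    using r by (auto simp: image_iff intro!: exI[of _ "inverse r *\<^sub>R _"])
  then have cl: "closure {x. ?\<phi> x \<noteq> 0} = (*\<^sub>R) r ` closure {x. \<phi> x \<noteq> 0}"
    by (simp add: closure_scaleR)
  have "compact (closure {x. ?\<phi> x \<noteq> 0})" "closure {x. ?\<phi> x \<noteq> 0} \<subseteq> U"
    unfolding cl using supp compact_scaling by blast+
  moreover have "?\<phi> \<in> schwartz"
    using \<phi> r by (intro schwartz_scaleR) auto
  ultimately have "fourier_distribution (c *\<^sub>R dilation r T) ?\<phi> = (LINT x|lborel. ?\<phi> x *s g x)"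
    using g by (simp add: agrees_on_def)
  also have "\<dots> = r ^ CARD('n) *\<^sub>R (LINT x|lborel. \<phi> x *s g (r *\<^sub>R x))"
    by (subst integral_lborel_scaleR[OF r]) (use r in simp)
  finally have "c *\<^sub>R fourier_distribution T \<phi> = r ^ CARD('n) *\<^sub>R (LINT x|lborel. \<phi> x *s g (r *\<^sub>R x))"
    by (simp add: fourier_distribution_dilation[OF T r \<phi>])
  then have "inverse c *\<^sub>R (c *\<^sub>R fourier_distribution T \<phi>) =
      inverse c *\<^sub>R (r ^ CARD('n) *\<^sub>R (LINT x|lborel. \<phi> x *s g (r *\<^sub>R x)))"
    by simp
  then have "fourier_distribution T \<phi> = (r ^ CARD('n) / c) *\<^sub>R (LINT x|lborel. \<phi> x *s g (r *\<^sub>R x))"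
    using c by (simp add: divide_inverse mult.commute)
  also have "\<dots> = (LINT x|lborel. (r ^ CARD('n) / c) *\<^sub>R (\<phi> x *s g (r *\<^sub>R x)))"
    by simp
  also have "(\<lambda>x. (r ^ CARD('n) / c) *\<^sub>R (\<phi> x *s g (r *\<^sub>R x))) =
      (\<lambda>x. \<phi> x *s ((r ^ CARD('n) / c) *\<^sub>R g (r *\<^sub>R x)))"
    by (simp add: fun_eq_iff vec_eq_iff)
  finally show "fourier_distribution T \<phi> = (LINT x|lborel. \<phi> x *s ((r ^ CARD('n) / c) *\<^sub>R g (r *\<^sub>R x)))" .
qed

section \<open>Scaling of the restricted L1 norm\<close>

text \<open>\<open>agrees_on\<close> constrains \<open>g\<close> only on compact subsets of
  \<open>U\<close>, so measurability is claimed for the cut-off function and not for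
  \<open>g\<close>.\<close>

lemma agrees_on_measurable:
  assumes "agrees_on T g U" "compact A" "A \<subseteq> U"
  shows "(\<lambda>x. indicat_real A x *\<^sub>R g x) \<in> borel_measurable borel"
proof -
  have "set_integrable lborel A g" using assms by (simp add: agrees_on_def)
  then show ?thesis by (auto simp: set_integrable_def dest: borel_measurable_integrable)
qed

text \<open>Every density admissible on the right yields one admissible on the left. Its factor r^d
  / c meets the Jacobian r^(-d) of the L1 norm, leaving 1/c, which the factor \<open>c\<close>
  absorbs. If the right side has no admissible density, it is infinite.\<close>

lemma restricted_norm_L1_dilation:
  fixes T :: "'n::finite distribution"
  assumes T: "T \<in> tempered" and r: "r > 0" and c: "c > 0" and A: "compact A"
  shows "ennreal c * restricted_norm L1_norm ((*\<^sub>R) r -` A) (fourier_distribution T)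
    \<le> restricted_norm L1_norm A (fourier_distribution (c *\<^sub>R dilation r T))"
  unfolding restricted_norm_def[of _ A]
proof (rule INF_greatest, safe)
  fix g U
  assume U: "open U" "A \<subseteq> U" and g: "agrees_on (fourier_distribution (c *\<^sub>R dilation r T)) g U"
  let ?g = "\<lambda>x. (r ^ CARD('n) / c) *\<^sub>R g (r *\<^sub>R x)" and ?A = "(*\<^sub>R) r -` A"
  have [measurable]: "(\<lambda>x. indicat_real A x *\<^sub>R g x) \<in> borel_measurable borel"
    using agrees_on_measurable[OF g A U(2)] .
  then have m: "(\<lambda>x. indicat_real A (r *\<^sub>R x) *\<^sub>R g (r *\<^sub>R x)) \<in> borel_measurable borel"
    using borel_measurable_scaleR_iff[of r "\<lambda>x. indicat_real A x *\<^sub>R g x"] r by simp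
  have "open ((*\<^sub>R) r -` U)"
    by (intro open_vimage U continuous_intros)
  then have "restricted_norm L1_norm ?A (fourier_distribution T) \<le> L1_norm (\<lambda>x. indicat_real ?A x *\<^sub>R ?g x)"
    unfolding restricted_norm_def using agrees_on_dilation[OF T r c g] U(2)
    by (intro INF_lower) (auto intro!: exI[of _ "(*\<^sub>R) r -` U"])
  then have "ennreal c * restricted_norm L1_norm ?A (fourier_distribution T)
      \<le> ennreal c * L1_norm (\<lambda>x. indicat_real ?A x *\<^sub>R ?g x)"
    by (rule mult_left_mono) simp
  also have "L1_norm (\<lambda>x. indicat_real ?A x *\<^sub>R ?g x) =
      (\<integral>\<^sup>+x. ennreal (r ^ CARD('n) / c) * ennreal (norm (indicat_real A (r *\<^sub>R x) *\<^sub>R g (r *\<^sub>R x))) \<partial>lborel)"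
    unfolding L1_norm_def using r c
    by (intro nn_integral_cong) (auto simp: ennreal_mult'[symmetric] indicator_def)
  also have "\<dots> = ennreal (r ^ CARD('n) / c) *
      (\<integral>\<^sup>+x. ennreal (norm (indicat_real A (r *\<^sub>R x) *\<^sub>R g (r *\<^sub>R x))) \<partial>lborel)"
    using measurable_compose[OF m, of "\<lambda>y. ennreal (norm y)" borel]
    by (intro nn_integral_cmult) (simp del: norm_scaleR)
  also have "ennreal c * \<dots> = ennreal (r ^ CARD('n)) *
      (\<integral>\<^sup>+x. ennreal (norm (indicat_real A (r *\<^sub>R x) *\<^sub>R g (r *\<^sub>R x))) \<partial>lborel)"
    using r c by (simp add: mult.assoc[symmetric] ennreal_mult'[symmetric])
  also have "\<dots> = L1_norm (\<lambda>x. indicat_real A x *\<^sub>R g x)"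
    unfolding L1_norm_def
    by (subst nn_integral_lborel_scaleR[OF r, of "\<lambda>x. ennreal (norm (indicat_real A x *\<^sub>R g x))"])
       (simp_all del: norm_scaleR)
  finally show "ennreal c * restricted_norm L1_norm ?A (fourier_distribution T)
      \<le> L1_norm (\<lambda>x. indicat_real A x *\<^sub>R g x)" .
qed

lemma compact_annulus: "compact (annulus a b :: (real^'n::finite) set)"
proof -
  have "annulus a b = (cball 0 b - ball 0 a :: (real^'n) set)"
    by (auto simp: annulus_def)
  then show ?thesis by (simp add: compact_diff)
qed

section \<open>From weak Lq to L1 on sets of finite measure\<close>

text \<open>This is the supremum in \<open>weak_norm\<close> read at the single height
  \<open>l\<close>. A level set of infinite measure would make that term infinite, against the
  finite bound \<open>W\<close>.\<close>

lemma emeasure_weak_norm_le: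
  assumes W: "weak_norm q f \<le> ennreal W" "W > 0" and q: "q > 0" and l: "l > 0"
  shows "emeasure lborel {x. l < norm (f x)} \<le> ennreal ((W / l) powr q)"
proof -
  let ?m = "emeasure lborel {x. l < norm (f x)}"
  have "ennreal l * (if ?m = \<infinity> then \<infinity> else ennreal (enn2real ?m powr (1 / q))) \<le> weak_norm q f"
    unfolding weak_norm_def Let_def using l by (intro SUP_upper) auto
  then have le: "ennreal l * (if ?m = \<infinity> then \<infinity> else ennreal (enn2real ?m powr (1 / q))) \<le> ennreal W"
    using W by order
  have fin: "?m \<noteq> \<infinity>"
    using le l by (auto simp: ennreal_mult_top top_unique)
  with le have "ennreal (l * enn2real ?m powr (1 / q)) \<le> ennreal W"
    using l by (simp add: ennreal_mult)
  then have "l * enn2real ?m powr (1 / q) \<le> W"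
    using W by simp
  then have "enn2real ?m powr (1 / q) \<le> W / l"
    using l by (simp add: field_simps)
  then have "(enn2real ?m powr (1 / q)) powr q \<le> (W / l) powr q"
    using q by (intro powr_mono2) auto
  then have "enn2real ?m \<le> (W / l) powr q"
    using q by (simp add: powr_powr)
  with fin show ?thesis
    by (metis ennreal_enn2real ennreal_leI infinity_ennreal_def top.not_eq_extremum)
qed

text \<open>The function is cut at the heights \<open>2\<^sup>k t\<close>. The choice of \<open>t\<close> balances the part below
  height \<open>t\<close> against the geometric series above it.\<close>

lemma L1_norm_le_weak_norm:
  fixes f :: "real^'n::finite \<Rightarrow> 'b::real_normed_vector"
  assumes f: "f \<in> borel_measurable borel" and A: "A \<in> sets borel" "\<And>x. x \<notin> A \<Longrightarrow> f x = 0"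
    and M: "emeasure lborel A \<le> ennreal M" "M > 0"
    and W: "weak_norm q f \<le> ennreal W" "W > 0" and q: "q > 1"
  shows "L1_norm f \<le> ennreal ((1 + 2 / (1 - 2 powr (1 - q))) * W * M powr (1 - 1 / q))"
proof -
  \<comment> \<open>At this height the weak-type bound (W/t)^q for the level set equals
    \<open>M\<close>, the bound for the measure of \<open>A\<close>.\<close>
  define t where "t = W * M powr (- 1 / q)"
  have t: "t > 0" using W M by (simp add: t_def)
  define B where "B k = {x. 2 ^ k * t < norm (f x)}" for k :: nat
  have B[measurable]: "B k \<in> sets borel" for k
    using f unfolding B_def by measurable
  have pt: "ennreal (norm (f x)) \<le>
      ennreal t * indicator A x + (\<Sum>k. ennreal (2 ^ (k + 1) * t) * indicator (B k) x)" for x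
  proof (cases "norm (f x) \<le> t")
    case True
    then have "ennreal (norm (f x)) \<le> ennreal t * indicator A x"
      using A(2)[of x] by (cases "x \<in> A") (auto simp: ennreal_leI)
    then show ?thesis by (rule order_trans) simp
  next
    case False
    obtain n where n: "norm (f x) / t < 2 ^ n"
      using real_arch_pow[of 2 "norm (f x) / t"] by auto
    \<comment> \<open>The least dyadic height dominating the value at \<open>x\<close>. It is not
      the zeroth one, so its predecessor \<open>k\<close> fails to dominate: \<open>x\<close> lies
      in \<open>B k\<close>, and the value is at most twice the height of \<open>B k\<close>. That
      single term of the series suffices.\<close>
    define m where "m = (LEAST n. norm (f x) \<le> 2 ^ n * t)"
    have ex: "norm (f x) \<le> 2 ^ n * t" using n t by (simp add: field_simps)
    have m: "norm (f x) \<le> 2 ^ m * t"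
      unfolding m_def by (rule LeastI[of _ n]) (rule ex)
    with False have "m \<noteq> 0" by (intro notI) simp
    then obtain k where k: "m = Suc k" using not0_implies_Suc by blast
    then have "\<not> norm (f x) \<le> 2 ^ k * t"
      using not_less_Least[of k "\<lambda>n. norm (f x) \<le> 2 ^ n * t"] m_def by simp
    then have "x \<in> B k" by (simp add: B_def)
    then have "ennreal (norm (f x)) \<le> ennreal (2 ^ (k + 1) * t) * indicator (B k) x"
      using m k by (simp add: ennreal_leI)
    also have "\<dots> = (\<Sum>i\<in>{k}. ennreal (2 ^ (i + 1) * t) * indicator (B i) x)"
      by (simp del: sum_mult_indicator)
    also have "\<dots> \<le> (\<Sum>k. ennreal (2 ^ (k + 1) * t) * indicator (B k) x)"
      by (rule sum_le_suminf) auto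
    finally show ?thesis by (rule order_trans) simp
  qed
  have tM: "t * M = W * M powr (1 - 1 / q)"
    using M by (simp add: t_def powr_diff powr_minus_divide field_simps)
  have Wt: "t * (W / t) powr q = W * M powr (1 - 1 / q)"
  proof -
    have "W / t = M powr (1 / q)"
      using M W by (simp add: t_def powr_minus_divide)
    then have "(W / t) powr q = M" using M q by (simp add: powr_powr)
    with tM show ?thesis by simp
  qed
  \<comment> \<open>Doubling the height doubles the factor in front but divides the measure bound by
    2^q. The ratio 2^(1-q) is below 1 because q > 1, so the series is geometric.\<close>
  have level: "2 ^ (k + 1) * t * (W / (2 ^ k * t)) powr q =
      2 * (W * M powr (1 - 1 / q)) * (2 powr (1 - q)) ^ k" for k
  proof -
    have "(W / (2 ^ k * t)) powr q = (W / t) powr q / (2 ^ k) powr q"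
      using W t by (simp add: powr_divide powr_mult)
    moreover have "(2 powr (1 - q)) ^ k = (2::real) ^ k / (2 ^ k) powr q"
      by (simp add: powr_power powr_realpow[symmetric] powr_powr powr_diff[symmetric] algebra_simps)
    ultimately show ?thesis using Wt[symmetric] by simp
  qed
  have lt1: "2 powr (1 - q) < (1::real)"
    using q by (simp add: powr_less_one)
  have "L1_norm f \<le> (\<integral>\<^sup>+x. ennreal t * indicator A x +
      (\<Sum>k. ennreal (2 ^ (k + 1) * t) * indicator (B k) x) \<partial>lborel)"
    unfolding L1_norm_def by (intro nn_integral_mono pt)
  also have "\<dots> = ennreal t * emeasure lborel A +
      (\<Sum>k. ennreal (2 ^ (k + 1) * t) * emeasure lborel (B k))"
    using A(1) by (subst nn_integral_add) (auto simp: nn_integral_suminf nn_integral_cmult_indicator)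
  also have "\<dots> \<le> ennreal t * ennreal M +
      (\<Sum>k. ennreal (2 ^ (k + 1) * t) * ennreal ((W / (2 ^ k * t)) powr q))"
    unfolding B_def using M W q t
    by (intro add_mono mult_left_mono suminf_le emeasure_weak_norm_le) auto
  also have "\<dots> = ennreal (t * M) +
      (\<Sum>k. ennreal (2 * (W * M powr (1 - 1 / q)) * (2 powr (1 - q)) ^ k))"
    using t M by (simp only: level[symmetric]) (simp add: ennreal_mult')
  also have "(\<Sum>k. ennreal (2 * (W * M powr (1 - 1 / q)) * (2 powr (1 - q)) ^ k)) =
      ennreal (2 * (W * M powr (1 - 1 / q)) * (1 / (1 - 2 powr (1 - q))))"
    using lt1 W M by (intro suminf_ennreal_eq sums_mult geometric_sums) auto
  also have "ennreal (t * M) + \<dots> = ennreal ((1 + 2 / (1 - 2 powr (1 - q))) * W * M powr (1 - 1 / q))"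
    unfolding tM using lt1 W M by (subst ennreal_plus[symmetric]) (auto simp: algebra_simps)
  finally show ?thesis .
qed

section \<open>Uniform bounds over the dyadic annuli\<close>

lemma fourier_besov_norm_L1_finite_dilation:
  fixes T :: "'n::finite distribution"
  assumes T: "T \<in> tempered"
    and bound: "\<And>r. r > 0 \<Longrightarrow>
      restricted_norm L1_norm (annulus 1 2) (fourier_distribution ((r powr \<beta>) *\<^sub>R dilation r T)) \<le> ennreal C"
  shows "fourier_besov_norm L1_norm (- \<beta>) T < \<infinity>"
proof -
  have "ennreal (2 powr (real_of_int j * - \<beta>)) *
      restricted_norm L1_norm (annulus (2 powi j) (2 powi (j + 1))) (fourier_distribution T) \<le> ennreal C"
    for j
  proof -
    define r :: real where "r = 2 powi (- j)"
    have r: "r > 0" by (simp add: r_def)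
    have "(*\<^sub>R) r -` annulus 1 2 = (annulus (2 powi j) (2 powi (j + 1)) :: (real^'n) set)"
      by (auto simp: annulus_def r_def power_int_minus power_int_add field_simps)
    \<comment> \<open>The factor gained from the dilation is exactly the dyadic weight of the target
      norm, so \<open>C\<close> bounds all blocks.\<close>
    moreover have "r powr \<beta> = 2 powr (real_of_int j * - \<beta>)"
      by (simp add: r_def powr_real_of_int'[symmetric] powr_powr)
    ultimately show ?thesis
      using restricted_norm_L1_dilation[OF T r, of "r powr \<beta>" "annulus 1 2"] bound[OF r] r
      by (simp add: compact_annulus order_trans)
  qed
  then have "fourier_besov_norm L1_norm (- \<beta>) T \<le> ennreal C"
    unfolding fourier_besov_norm_def by (intro SUP_least)
  then show ?thesis by (simp add: le_less_trans)
qed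

lemma fourier_besov_norm_L1_finite_weak:
  fixes T :: "'n::finite distribution"
  assumes fin: "fourier_besov_norm (weak_norm q) (- s) T < \<infinity>" and q: "q > 1"
  shows "fourier_besov_norm L1_norm (- (s + real CARD('n) * (1 - 1 / q))) T < \<infinity>"
proof -
  obtain B where B: "fourier_besov_norm (weak_norm q) (- s) T = ennreal B" "B \<ge> 0"
    using fin by (cases "fourier_besov_norm (weak_norm q) (- s) T") auto
  let ?d = "real CARD('n)" and ?K = "1 + 2 / (1 - 2 powr (1 - q))"
  let ?\<beta> = "s + ?d * (1 - 1 / q)"
  define V where "V = unit_ball_vol ?d"
  have V: "V > 0" by (simp add: V_def)
  \<comment> \<open>This is the bound obtained for j = 0; for the other blocks all powers of 2^j
    cancel against the weight.\<close>
  define D where "D = ?K * (B + 1) * (V * 2 powr ?d) powr (1 - 1 / q)"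
  have "ennreal (2 powr (real_of_int j * - ?\<beta>)) *
      restricted_norm L1_norm (annulus (2 powi j) (2 powi (j + 1))) (fourier_distribution T) \<le> ennreal D"
    for j
  proof -
    let ?A = "annulus (2 powi j) (2 powi (j + 1)) :: (real^'n) set"
    \<comment> \<open>B + 1 in place of B makes the bound on the infimum strict, so that an actual
      density \<open>g\<close> can be extracted below it, and keeps \<open>W\<close> positive when B
      = 0.\<close>
    define W where "W = (B + 1) * 2 powr (real_of_int j * s)"
    define M where "M = V * (2 powi (j + 1)) ^ CARD('n)"
    have W: "W > 0" using B by (simp add: W_def)
    have M: "M > 0" using V by (simp add: M_def)
    have "ennreal (2 powr (real_of_int j * - s)) * restricted_norm (weak_norm q) ?A (fourier_distribution T)
        \<le> ennreal B"
      unfolding B(1)[symmetric] fourier_besov_norm_def by (rule SUP_upper) simp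
    then have "ennreal (2 powr (real_of_int j * s)) * (ennreal (2 powr (real_of_int j * - s)) *
        restricted_norm (weak_norm q) ?A (fourier_distribution T)) \<le> ennreal (2 powr (real_of_int j * s)) * ennreal B"
      by (rule mult_left_mono) simp
    then have "restricted_norm (weak_norm q) ?A (fourier_distribution T) \<le> ennreal (2 powr (real_of_int j * s) * B)"
      by (simp add: mult.assoc[symmetric] ennreal_mult'[symmetric] powr_add[symmetric])
    also have "\<dots> < ennreal W"
      using B by (intro ennreal_lessI) (auto simp: W_def)
    finally obtain g U where g: "open U" "?A \<subseteq> U" "agrees_on (fourier_distribution T) g U"
      and gW: "weak_norm q (\<lambda>x. indicat_real ?A x *\<^sub>R g x) < ennreal W"
      unfolding restricted_norm_def by (auto simp: INF_less_iff)
    \<comment> \<open>The annulus is measured by its outer ball, which has the right order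
      2^(jd).\<close>
    have "emeasure lborel ?A \<le> emeasure lborel (cball (0::real^'n) (2 powi (j + 1)))"
      by (intro emeasure_mono) (auto simp: annulus_def)
    also have "\<dots> = ennreal M"
      by (simp add: emeasure_cball M_def V_def)
    finally have "L1_norm (\<lambda>x. indicat_real ?A x *\<^sub>R g x) \<le> ennreal (?K * W * M powr (1 - 1 / q))"
      using gW W M q agrees_on_measurable[OF g(3) compact_annulus g(2)]
      by (intro L1_norm_le_weak_norm[where A = ?A]) (auto simp: borel_compact compact_annulus)
    moreover have "restricted_norm L1_norm ?A (fourier_distribution T) \<le> L1_norm (\<lambda>x. indicat_real ?A x *\<^sub>R g x)"
      unfolding restricted_norm_def using g by (intro INF_lower) auto
    ultimately have "restricted_norm L1_norm ?A (fourier_distribution T) \<le> ennreal (?K * W * M powr (1 - 1 / q))"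
      by order
    then have "ennreal (2 powr (real_of_int j * - ?\<beta>)) * restricted_norm L1_norm ?A (fourier_distribution T)
        \<le> ennreal (2 powr (real_of_int j * - ?\<beta>)) * ennreal (?K * W * M powr (1 - 1 / q))"
      by (rule mult_left_mono) simp
    also have "\<dots> = ennreal (2 powr (real_of_int j * - ?\<beta>) * (?K * W * M powr (1 - 1 / q)))"
      by (simp add: ennreal_mult')
    also have "2 powr (real_of_int j * - ?\<beta>) * (?K * W * M powr (1 - 1 / q)) = D"
    proof -
      have "M = (V * 2 powr ?d) * 2 powr (real_of_int j * ?d)"
        unfolding M_def
        by (simp add: powr_real_of_int'[symmetric] powr_realpow[symmetric] powr_powr
            powr_add[symmetric] algebra_simps)
      then have "M powr (1 - 1 / q) =
          (V * 2 powr ?d) powr (1 - 1 / q) * 2 powr (real_of_int j * ?d * (1 - 1 / q))"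
        using V by (simp add: powr_mult powr_powr)
      moreover have "2 powr (real_of_int j * - ?\<beta>) *
          (2 powr (real_of_int j * s) * 2 powr (real_of_int j * ?d * (1 - 1 / q))) = 1"
        by (simp add: powr_add[symmetric] algebra_simps)
      ultimately show ?thesis
        unfolding D_def W_def by (simp add: mult_ac)
    qed
    finally show ?thesis .
  qed
  then have "fourier_besov_norm L1_norm (- ?\<beta>) T \<le> ennreal D"
    unfolding fourier_besov_norm_def by (intro SUP_least)
  then show ?thesis by (simp add: le_less_trans)
qed

theorem proposition1p1:
  assumes "2 \<le> CARD('n::finite)"
  shows
    "(\<forall>(E :: 'n distribution set) (N :: 'n distribution \<Rightarrow> real) (\<beta>::real).
        banach_space_on E N \<and>
        regular_distribution ` schwartz \<subseteq> E \<and>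
        E \<subseteq> tempered \<and>
        (\<exists>C>0. \<forall>\<psi>\<in>E. restricted_norm L1_norm (annulus 1 2) (fourier_distribution \<psi>)
                        \<le> ennreal (C * N \<psi>)) \<and>
        (\<forall>r>0. \<forall>\<psi>\<in>E. (r powr \<beta>) *\<^sub>R dilation r \<psi> \<in> E \<and>
                        N ((r powr \<beta>) *\<^sub>R dilation r \<psi>) = N \<psi>)
        \<longrightarrow> E // mod_polynomials \<subseteq> fourier_besov L1_norm (- \<beta>))
     \<and>
     (\<forall>(\<beta>::real) (p::real) (q::real) (q'::real) (\<alpha>::real).
        1 < p \<and> 1 < q \<and> 1 / q + 1 / q' = 1 \<and> 1 < \<alpha> \<and> \<alpha> < 2 \<and>
        \<alpha> / p + real CARD('n) / q' = \<beta>
        \<longrightarrow> (fourier_besov (weak_norm q) (- (\<alpha> / p)) :: 'n distribution set set)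
              \<subseteq> fourier_besov L1_norm (- \<beta>))"
proof (intro conjI allI impI)
  fix E :: "'n distribution set" and N :: "'n distribution \<Rightarrow> real" and \<beta> :: real
  assume *: "banach_space_on E N \<and>
        regular_distribution ` schwartz \<subseteq> E \<and>
        E \<subseteq> tempered \<and>
        (\<exists>C>0. \<forall>\<psi>\<in>E. restricted_norm L1_norm (annulus 1 2) (fourier_distribution \<psi>)
                        \<le> ennreal (C * N \<psi>)) \<and>
        (\<forall>r>0. \<forall>\<psi>\<in>E. (r powr \<beta>) *\<^sub>R dilation r \<psi> \<in> E \<and>
                        N ((r powr \<beta>) *\<^sub>R dilation r \<psi>) = N \<psi>)"
  then obtain C where C: "\<And>\<psi>. \<psi> \<in> E \<Longrightarrow>
      restricted_norm L1_norm (annulus 1 2) (fourier_distribution \<psi>) \<le> ennreal (C * N \<psi>)"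
    by blast
  have "fourier_besov_norm L1_norm (- \<beta>) T < \<infinity>" if T: "T \<in> E" for T
  proof (rule fourier_besov_norm_L1_finite_dilation)
    show "T \<in> tempered" using * T by blast
    show "restricted_norm L1_norm (annulus 1 2) (fourier_distribution ((r powr \<beta>) *\<^sub>R dilation r T))
        \<le> ennreal (C * N T)" if "r > 0" for r
      using C[of "(r powr \<beta>) *\<^sub>R dilation r T"] * T that by simp
  qed
  \<comment> \<open>Both sides are quotients by the same relation, so it suffices to compare the
    underlying sets of representatives.\<close>
  with * show "E // mod_polynomials \<subseteq> fourier_besov L1_norm (- \<beta>)"
    unfolding fourier_besov_def quotient_def by blast
next
  fix \<beta> p q q' \<alpha> :: real
  assume *: "1 < p \<and> 1 < q \<and> 1 / q + 1 / q' = 1 \<and> 1 < \<alpha> \<and> \<alpha> < 2 \<and>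
    \<alpha> / p + real CARD('n) / q' = \<beta>"
  then have "1 / q' = 1 - 1 / q" by simp
  \<comment> \<open>Here d/q' becomes d (1 - 1/q), the exponent produced by the measure of the
    annulus.\<close>
  with * have "\<beta> = \<alpha> / p + real CARD('n) * (1 - 1 / q)"
    by (metis times_divide_eq_right mult.right_neutral)
  then have "fourier_besov_norm L1_norm (- \<beta>) T < \<infinity>"
    if "fourier_besov_norm (weak_norm q) (- (\<alpha> / p)) T < \<infinity>" for T :: "'n distribution"
    using fourier_besov_norm_L1_finite_weak[OF that] * by simp
  then show "(fourier_besov (weak_norm q) (- (\<alpha> / p)) :: 'n distribution set set)
      \<subseteq> fourier_besov L1_norm (- \<beta>)"
    unfolding fourier_besov_def quotient_def by blast
qed

end
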